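(* Let $T$ be a triangle with vertices $y_1,y_2,y_3$, let $r\in[1,3/2]$, and let $M$ be a point of the boundary $\partial(\mathscr{T}_r)$ lying in the interior of $T$. Let $\gamma_n(r,M)$ be the domination number of the $r$-factor proportional-edge proximity catch digraph with $M$-vertex regions on $n$ iid points uniformly distributed on $T$. Then $P(\gamma_n(r,M)>1)\to1$ as $n\to\infty$.
   Context: Let $y_1,y_2,y_3\in\mathbb{R}^2$ be non-collinear, $T$ the closed triangle with these vertices, $e_j$ the edge opposite $y_j$, and $b_j(x)$ the barycentric coordinate of $x\in T$ with respect to $y_j$. Define $\mathscr{T}_r:=\{x\in T: b_j(x)\ge 1-1/r \text{ for } j=1,2,3\}$, the triangle bounded by the lines $q_j$ parallel to $e_j$ with $d(y_j,e_j)=r\,d(y_j,q_j)$ (a single point, the centroid, when $r=3/2$). For $M$ in the interior of $T$ and $k=1,2,3$, let $M_k$ be the point where the line through $y_k$ and $M$ meets $e_k$; the $M$-vertex region $R_M(y_j)$ is the closed quadrilateral with vertices $y_j,M_k,M,M_l$, $\{j,k,l\}=\{1,2,3\}$. For $x\in T\setminus\{y_1,y_2,y_3\}$ let $v(x)=y_j$ where $x\in R_M(y_j)$ (arbitrary choice on common boundaries). For such $x$ with $v(x)=y_j$, $N^r_{PE}(x,M)=\{z\in T: 1-b_j(z)\le r(1-b_j(x))\}$ (the intersection with $T$ of the triangle similar to $T$ with vertex $y_j$ whose opposite side is parallel to $e_j$ at $r$ times the distance from $y_j$ to the line through $x$ parallel to $e_j$); $N^r_{PE}(y_j,M)=\{y_j\}$.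 The digraph on $\{X_1,\dots,X_n\}$ has an arc $X_i\to X_j$ ($i\ne j$) iff $X_j\in N^r_{PE}(X_i,M)$; the domination number is the minimum cardinality of a vertex set $S$ such that every vertex is in $S$ or is the head of an arc from $S$. *)

theory Defs
  imports "HOL-Probability.Probability" "Graph_Theory.Pair_Digraph"
begin

(* The vertices of the triangle are y 1, y 2, y 3, indexed by the three-element type 3
   (in which 3 = 0). *)

definition closed_triangle :: "(3 \<Rightarrow> real^2) \<Rightarrow> (real^2) set" where
  "closed_triangle y = convex hull (range y)"

definition opposite_edge :: "(3 \<Rightarrow> real^2) \<Rightarrow> 3 \<Rightarrow> (real^2) set" where
  "opposite_edge y j = convex hull (y ` (UNIV - {j}))"

(* Well defined when y 1, y 2, y 3 are not collinear. *)
definition barycentric :: "(3 \<Rightarrow> real^2) \<Rightarrow> real^2 \<Rightarrow> 3 \<Rightarrow> real" where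
  "barycentric y x = (THE b. (\<Sum>j\<in>UNIV. b j) = 1 \<and> (\<Sum>j\<in>UNIV. b j *\<^sub>R y j) = x)"

definition inner_triangle :: "(3 \<Rightarrow> real^2) \<Rightarrow> real \<Rightarrow> (real^2) set" where
  "inner_triangle y r = {x \<in> closed_triangle y. \<forall>j. barycentric y x j \<ge> 1 - 1 / r}"

(* Well defined when y 1, y 2, y 3 are not collinear and M is interior to the triangle. *)
definition cevian_foot :: "(3 \<Rightarrow> real^2) \<Rightarrow> real^2 \<Rightarrow> 3 \<Rightarrow> real^2" where
  "cevian_foot y M k = (THE p. p \<in> affine hull {y k, M} \<and> p \<in> opposite_edge y k)"

(* The quadrilateral y_j, M_k, M, M_l is cut out of the triangle by the half-planes bounded by
   the cevians from y_k and y_l, so it is convex and equals the convex hull of its vertices. *)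
definition vertex_region :: "(3 \<Rightarrow> real^2) \<Rightarrow> real^2 \<Rightarrow> 3 \<Rightarrow> (real^2) set" where
  "vertex_region y M j = convex hull ({y j, M} \<union> cevian_foot y M ` (UNIV - {j}))"

(* v x = j stands for v(x) = y_j.  The choice is arbitrary, possibly non-measurable, where vertex
   regions overlap; as this happens only on a null set, probabilities of events that depend on v
   are to be taken in the completion of the probability space. *)
definition vertex_choice :: "(3 \<Rightarrow> real^2) \<Rightarrow> real^2 \<Rightarrow> (real^2 \<Rightarrow> 3) \<Rightarrow> bool" where
  "vertex_choice y M v \<longleftrightarrow> (\<forall>x \<in> closed_triangle y - range y. x \<in> vertex_region y M (v x))"

(* The point M enters the proximity region only through the choice function v. *)
definition proximity_region ::
    "(3 \<Rightarrow> real^2) \<Rightarrow> real \<Rightarrow> (real^2 \<Rightarrow> 3) \<Rightarrow> real^2 \<Rightarrow> (real^2) set" where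
  "proximity_region y r v x =
     (if x \<in> range y then {x}
      else {z \<in> closed_triangle y. 1 - barycentric y z (v x) \<le> r * (1 - barycentric y x (v x))})"

definition proximity_digraph ::
    "(3 \<Rightarrow> real^2) \<Rightarrow> real \<Rightarrow> (real^2 \<Rightarrow> 3) \<Rightarrow> (real^2) set \<Rightarrow> (real^2) pair_pre_digraph" where
  "proximity_digraph y r v V =
     \<lparr>pverts = V,
      parcs = {(x, z). x \<in> V \<and> z \<in> V \<and> x \<noteq> z \<and> z \<in> proximity_region y r v x}\<rparr>"

definition dominating_set :: "'a pair_pre_digraph \<Rightarrow> 'a set \<Rightarrow> bool" where
  "dominating_set G S \<longleftrightarrow>
     S \<subseteq> pverts G \<and> (\<forall>w \<in> pverts G. w \<in> S \<or> (\<exists>s \<in> S. (s, w) \<in> parcs G))"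

(* Intended for digraphs with finitely many vertices. *)
definition domination_number :: "'a pair_pre_digraph \<Rightarrow> nat" where
  "domination_number G = (LEAST k. \<exists>S. dominating_set G S \<and> card S = k)"

end

theory Submission
  imports Defs "HOL-Real_Asymp.Real_Asymp"
begin

text \<open>
  Write \<open>b\<^sub>j\<close> for the barycentric coordinates and \<open>m = b(M)\<close>.  The vertex region of \<open>y\<^sub>j\<close> lies in
  \<open>{x. b\<^sub>k(x) / m\<^sub>k \<le> b\<^sub>j(x) / m\<^sub>j for all k}\<close>, and there \<open>b\<^sub>j(x) \<le> m\<^sub>j + d\<close> forces \<open>|x - M| = O(d)\<close>.
  A single point \<open>x\<close> with \<open>v(x) = y\<^sub>j\<close> dominates the sample iff \<open>b\<^sub>j(x) \<le> 1 - (1 - \<epsilon>) / r\<close>, where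
  \<open>\<epsilon>\<close> is the least value of \<open>b\<^sub>j\<close> on the sample.  As \<open>m\<^sub>j \<ge> 1 - 1/r\<close>, such an \<open>x\<close> satisfies
  \<open>b\<^sub>j(x) \<le> m\<^sub>j + \<epsilon>\<close>, hence lies within \<open>O(\<epsilon>)\<close> of \<open>M\<close>.  Take \<open>d = n\<^bsup>-3/4\<^esup>\<close>: since \<open>n d\<close> tends to
  infinity, \<open>\<epsilon> < d\<close> with high probability, and since \<open>n d\<^sup>2\<close> tends to 0, with high probability
  no sample point is within \<open>O(d)\<close> of \<open>M\<close>.
\<close>

text \<open>The set of all vertices is dominating, so the minimum is attained. Nonemptiness excludes
  the value 0, and finiteness excludes infinite sets, whose \<open>card\<close> is 0 by
  default.\<close>

lemma domination_number_gt_1_iff: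
  assumes "finite (pverts G)" "pverts G \<noteq> {}"
  shows "domination_number G > 1 \<longleftrightarrow> \<not> (\<exists>s\<in>pverts G. \<forall>w\<in>pverts G. w = s \<or> (s, w) \<in> parcs G)"
proof
  assume gt: "domination_number G > 1"
  show "\<not> (\<exists>s\<in>pverts G. \<forall>w\<in>pverts G. w = s \<or> (s, w) \<in> parcs G)"
  proof
    assume "\<exists>s\<in>pverts G. \<forall>w\<in>pverts G. w = s \<or> (s, w) \<in> parcs G"
    then obtain s where "dominating_set G {s}" by (auto simp: dominating_set_def)
    then have "domination_number G \<le> 1"
      unfolding domination_number_def by (intro Least_le exI[of _ "{s}"]) simp
    then show False using gt by simp
  qed
next
  assume no: "\<not> (\<exists>s\<in>pverts G. \<forall>w\<in>pverts G. w = s \<or> (s, w) \<in> parcs G)"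
  have "\<exists>S. dominating_set G S \<and> card S = domination_number G"
    unfolding domination_number_def
    by (rule LeastI_ex, rule exI[of _ "card (pverts G)"], rule exI[of _ "pverts G"])
       (simp add: dominating_set_def)
  then obtain S where S: "dominating_set G S" "card S = domination_number G" by blast
  have fin: "finite S" using S(1) assms(1) by (auto simp: dominating_set_def intro: finite_subset)
  have "S \<noteq> {}" using S(1) assms(2) by (auto simp: dominating_set_def)
  then have "card S \<noteq> 0" using fin by simp
  moreover have "card S \<noteq> 1"
  proof
    assume "card S = 1"
    then obtain s where "S = {s}" by (auto simp: card_1_singleton_iff)
    then show False using S(1) no by (auto simp: dominating_set_def)
  qed
  ultimately show "domination_number G > 1" using S(2) by linarith
qed

text \<open>Used in contrapositive form: for a nondegenerate triangle the determinant of two edge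
  vectors is nonzero, so that barycentric coordinates can be solved for.\<close>

lemma collinear_if_cross_zero:
  fixes a b c :: "real^2"
  assumes "(b$1 - a$1) * (c$2 - a$2) = (b$2 - a$2) * (c$1 - a$1)"
  shows "collinear {a, b, c}"
proof (cases "a = c")
  case False
  have "\<exists>t. b - a = t *\<^sub>R (c - a)"
  proof (cases "c$1 = a$1")
    case True
    then have n: "c$2 - a$2 \<noteq> 0" using False by (auto simp: vec_eq_iff forall_2)
    show ?thesis
      by (rule exI[of _ "(b$2 - a$2) / (c$2 - a$2)"])
         (use assms n True in \<open>auto simp: vec_eq_iff forall_2\<close>)
  next
    case False
    then have n: "c$1 - a$1 \<noteq> 0" by simp
    show ?thesis
      by (rule exI[of _ "(b$1 - a$1) / (c$1 - a$1)"])
         (use assms n in \<open>auto simp: vec_eq_iff forall_2\<close>)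
  qed
  then obtain t where t: "b - a = t *\<^sub>R (c - a)" by blast
  have "b = (1 - t) *\<^sub>R a + (1 - (1 - t)) *\<^sub>R c"
    using t by (simp add: algebra_simps)
  then show ?thesis unfolding collinear_3_expand by blast
qed (simp add: insert_commute)

section \<open>Barycentric coordinates of a nondegenerate triangle\<close>

locale triangle =
  fixes y :: "3 \<Rightarrow> real^2"
  assumes noncollinear: "\<not> collinear {y 1, y 2, y 3}"
begin

abbreviation "T \<equiv> closed_triangle y"
abbreviation "b \<equiv> barycentric y"

text \<open>Cramer's rule in the basis of edge vectors issuing from \<open>y 1\<close>. The
  resulting affine functions, dual to the vertices, are the barycentric coordinates.\<close>

lemma ex_barycentric_functionals:
  "\<exists>P Q. (\<forall>j k. P j \<bullet> y k + Q j = (if j = k then 1 else (0::real))) \<and>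
     (\<forall>x. (\<Sum>j\<in>UNIV. P j \<bullet> x + Q j) = 1 \<and> (\<Sum>j\<in>UNIV. (P j \<bullet> x + Q j) *\<^sub>R y j) = x)"
proof -
  define u w where "u = y 2 - y 1" and "w = y 3 - y 1"
  define D where "D = u$1 * w$2 - u$2 * w$1"
  have D: "D \<noteq> 0"
    using noncollinear collinear_if_cross_zero[of "y 2" "y 1" "y 3"]
    by (auto simp: D_def u_def w_def)
  \<comment> \<open>\<open>p\<close> and \<open>q\<close> are the rows of the inverse of the matrix
    with columns \<open>u\<close> and \<open>w\<close>, that is, the dual basis.\<close>
  define p q :: "real^2" where "p = vector [w$2 / D, - w$1 / D]" and "q = vector [- u$2 / D, u$1 / D]"
  \<comment> \<open>The functions for the indices 2 and 3 are \<open>p\<close> and \<open>q\<close>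
    applied to \<open>x - y 1\<close>; the one for index 1 makes the sum equal to 1.\<close>
  define P where "P j = (if j = (2::3) then p else if j = 3 then q else - p - q)" for j
  define Q where "Q j = (if j = (2::3) then - (p \<bullet> y 1) else if j = 3 then - (q \<bullet> y 1)
    else 1 + p \<bullet> y 1 + q \<bullet> y 1)" for j
  have y2: "y 2 = y 1 + u" and y3: "y 3 = y 1 + w" by (simp_all add: u_def w_def)
  have dual: "p \<bullet> u = 1" "p \<bullet> w = 0" "q \<bullet> u = 0" "q \<bullet> w = 1"
    using D by (simp_all add: inner_vec_def sum_2 p_def q_def field_simps) (simp_all add: D_def)
  have id: "(p \<bullet> z) *\<^sub>R u + (q \<bullet> z) *\<^sub>R w = z" for z
  proof -
    have "((w$2 * z$1 - w$1 * z$2) / D) * u$1 + ((u$1 * z$2 - u$2 * z$1) / D) * w$1 = z$1 * D / D"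
      unfolding times_divide_eq_left add_divide_distrib[symmetric] by (simp add: D_def algebra_simps)
    moreover have "((w$2 * z$1 - w$1 * z$2) / D) * u$2 + ((u$1 * z$2 - u$2 * z$1) / D) * w$2 = z$2 * D / D"
      unfolding times_divide_eq_left add_divide_distrib[symmetric] by (simp add: D_def algebra_simps)
    ultimately show ?thesis
      using D by (simp add: vec_eq_iff forall_2 inner_vec_def sum_2 p_def q_def diff_divide_distrib)
  qed
  have sc: "(\<Sum>j\<in>UNIV. (P j \<bullet> x + Q j) *\<^sub>R y j) = x" for x
  proof -
    have "(\<Sum>j\<in>UNIV. (P j \<bullet> x + Q j) *\<^sub>R y j) = y 1 + ((p \<bullet> (x - y 1)) *\<^sub>R u + (q \<bullet> (x - y 1)) *\<^sub>R w)"
      unfolding sum_3 y2 y3 by (simp add: P_def Q_def algebra_simps inner_diff_right)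
    also have "\<dots> = x" unfolding id by simp
    finally show ?thesis .
  qed
  have s1: "(\<Sum>j\<in>UNIV. P j \<bullet> x + Q j) = 1" for x
    by (simp add: sum_3 P_def Q_def algebra_simps)
  have pq: "\<forall>j k. P j \<bullet> y k + Q j = (if j = k then 1 else (0::real))"
    unfolding forall_3 y2 y3 using dual by (simp add: P_def Q_def inner_add_right inner_diff_left)
  show ?thesis using s1 sc pq by blast
qed

text \<open>Applying the j-th dual function to an affine combination of the vertices returns its
  j-th coefficient. This discharges the definite description behind
  \<open>barycentric\<close>.\<close>

lemma barycentric_unique:
  assumes "sum c UNIV = 1" "(\<Sum>j\<in>UNIV. c j *\<^sub>R y j) = x"
  shows "b x = c"
proof -
  obtain P Q where d: "\<And>j k. P j \<bullet> y k + Q j = (if j = k then 1 else (0::real))"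
    using ex_barycentric_functionals by blast
  have *: "P j \<bullet> x + Q j = c' j" if "sum c' UNIV = 1" "(\<Sum>j\<in>UNIV. c' j *\<^sub>R y j) = x" for c' j
  proof -
    have "P j \<bullet> x + Q j = (\<Sum>k\<in>UNIV. c' k * (P j \<bullet> y k)) + Q j * sum c' UNIV"
      using that by (simp flip: that(2) add: inner_sum_right)
    also have "\<dots> = (\<Sum>k\<in>UNIV. c' k * (P j \<bullet> y k + Q j))"
      by (simp add: sum_distrib_left sum.distrib distrib_left mult.commute)
    also have "\<dots> = c' j" by (simp add: d if_distrib cong: if_cong)
    finally show ?thesis .
  qed
  show ?thesis unfolding barycentric_def
  proof (rule the_equality)
    show "c' = c" if "sum c' UNIV = 1 \<and> (\<Sum>j\<in>UNIV. c' j *\<^sub>R y j) = x" for c'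
      using *[of c'] *[OF assms] that by (auto simp: fun_eq_iff)
  qed (use assms in simp)
qed

lemma barycentric_affine: "\<exists>P Q. \<forall>x j. b x j = P j \<bullet> x + Q j"
proof -
  obtain P Q where *: "\<And>x. (\<Sum>j\<in>UNIV. P j \<bullet> x + Q j) = (1::real)"
     "\<And>x. (\<Sum>j\<in>UNIV. (P j \<bullet> x + Q j) *\<^sub>R y j) = x"
    using ex_barycentric_functionals by blast
  have "b x j = P j \<bullet> x + Q j" for x j
    using barycentric_unique[OF *] by simp
  then show ?thesis by blast
qed

lemma barycentric_props: "sum (b x) UNIV = 1 \<and> (\<Sum>j\<in>UNIV. b x j *\<^sub>R y j) = x"
proof -
  obtain P Q where *: "\<And>x. (\<Sum>j\<in>UNIV. P j \<bullet> x + Q j) = (1::real)"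
     "\<And>x. (\<Sum>j\<in>UNIV. (P j \<bullet> x + Q j) *\<^sub>R y j) = x"
    using ex_barycentric_functionals by blast
  show ?thesis using barycentric_unique[OF *, of x] * by simp
qed

lemma sum_barycentric: "sum (b x) UNIV = 1"
  and barycentric_combination: "(\<Sum>j\<in>UNIV. b x j *\<^sub>R y j) = x"
  using barycentric_props by auto

lemma barycentric_vertex: "b (y k) j = (if j = k then 1 else 0)"
proof -
  have "(\<Sum>j\<in>UNIV. (if j = k then 1 else 0) *\<^sub>R y j) = (\<Sum>j\<in>UNIV. if j = k then y j else 0)"
    by (rule sum.cong) auto
  also have "\<dots> = y k" by (simp only: sum.delta finite UNIV_I if_True)
  finally have "b (y k) = (\<lambda>j. if j = k then 1 else 0)"
    by (intro barycentric_unique) (simp_all only: sum.delta finite UNIV_I if_True)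
  then show ?thesis by simp
qed

lemma barycentric_affine_combination:
  assumes "s + t = 1"
  shows "b (s *\<^sub>R x + t *\<^sub>R z) j = s * b x j + t * b z j"
proof -
  obtain P Q where a: "\<And>x j. b x j = P j \<bullet> x + Q j" using barycentric_affine by blast
  have s: "s = 1 - t" using assms by simp
  show ?thesis unfolding s a by (simp add: algebra_simps)
qed

lemma continuous_on_barycentric [continuous_intros]: "continuous_on S (\<lambda>x. b x j)"
proof -
  obtain P Q where a: "\<And>x j. b x j = P j \<bullet> x + Q j" using barycentric_affine by blast
  show ?thesis by (simp add: a) (intro continuous_intros)
qed

lemma barycentric_measurable [measurable]: "(\<lambda>x. b x j) \<in> borel_measurable borel"
  by (intro borel_measurable_continuous_onI continuous_on_barycentric)

lemma in_closed_triangle_iff: "x \<in> T \<longleftrightarrow> (\<forall>j. 0 \<le> b x j)"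
proof
  assume "x \<in> T"
  then have "x \<in> convex hull (range y)" by (simp add: closed_triangle_def)
  also have "\<dots> \<subseteq> {x. \<forall>j. 0 \<le> b x j}"
  proof (rule hull_minimal)
    show "convex {x. \<forall>j. 0 \<le> b x j}"
      by (auto intro!: convexI simp: barycentric_affine_combination)
  qed (auto simp: barycentric_vertex)
  finally show "\<forall>j. 0 \<le> b x j" by simp
next
  assume "\<forall>j. 0 \<le> b x j"
  then have "(\<Sum>j\<in>UNIV. b x j *\<^sub>R y j) \<in> convex hull (range y)"
    by (intro convex_sum) (auto simp: sum_barycentric hull_inc)
  then show "x \<in> T" by (simp add: closed_triangle_def barycentric_combination)
qed

lemma compact_triangle: "compact T"
  unfolding closed_triangle_def by (simp add: compact_convex_hull finite_imp_compact)

lemma in_opposite_edge_iff: "x \<in> opposite_edge y k \<longleftrightarrow> b x k = 0 \<and> (\<forall>j. 0 \<le> b x j)"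
proof
  assume "x \<in> opposite_edge y k"
  then have "x \<in> convex hull (y ` (UNIV - {k}))" by (simp add: opposite_edge_def)
  also have "\<dots> \<subseteq> {x. b x k = 0 \<and> (\<forall>j. 0 \<le> b x j)}"
  proof (rule hull_minimal)
    show "convex {x. b x k = 0 \<and> (\<forall>j. 0 \<le> b x j)}"
      by (auto intro!: convexI simp: barycentric_affine_combination)
  qed (auto simp: barycentric_vertex)
  finally show "b x k = 0 \<and> (\<forall>j. 0 \<le> b x j)" by simp
next
  assume A: "b x k = 0 \<and> (\<forall>j. 0 \<le> b x j)"
  have "sum (b x) (UNIV - {k}) = 1"
    using A sum_barycentric[of x] by (simp add: sum_diff1)
  then have "(\<Sum>j\<in>UNIV - {k}. b x j *\<^sub>R y j) \<in> convex hull (y ` (UNIV - {k}))"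
    using A by (intro convex_sum) (auto simp: hull_inc)
  moreover have "(\<Sum>j\<in>UNIV - {k}. b x j *\<^sub>R y j) = x"
    using A barycentric_combination[of x] by (simp add: sum_diff1)
  ultimately show "x \<in> opposite_edge y k" by (simp add: opposite_edge_def)
qed

text \<open>A small step from \<open>x\<close> against the gradient of the coordinate stays in
  \<open>T\<close> and strictly decreases a coordinate that is nonnegative on
  \<open>T\<close>.\<close>

lemma barycentric_pos_interior:
  assumes "x \<in> interior T"
  shows "0 < b x j"
proof -
  obtain P Q where a: "\<And>x j. b x j = P j \<bullet> x + Q j" using barycentric_affine by blast
  \<comment> \<open>The coordinate is not constant: it is 1 at \<open>y j\<close> and 0 at another
    vertex.\<close>
  have Pj: "P j \<noteq> 0"
    using barycentric_vertex[of j j] barycentric_vertex[of "j + 1" j] by (auto simp: a)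
  obtain e where e: "e > 0" "cball x e \<subseteq> T" using assms mem_interior_cball by blast
  define z where "z = x - (e / norm (P j)) *\<^sub>R P j"
  have "z \<in> T" using e Pj by (intro subsetD[OF e(2)]) (simp add: z_def dist_norm)
  then have "0 \<le> b z j" by (simp add: in_closed_triangle_iff)
  also have "b z j = b x j - e / norm (P j) * (P j \<bullet> P j)"
    by (simp add: a z_def inner_diff_right)
  also have "\<dots> < b x j" using e Pj by simp
  finally show ?thesis .
qed

section \<open>Vertex regions in barycentric coordinates\<close>

text \<open>The half-planes are bounded by the cevians through \<open>M\<close>. Comparing the
  ratios of coordinates of \<open>x\<close> and \<open>M\<close> without division leaves linear
  inequalities, from which convexity and closedness are immediate.\<close>

definition region :: "real^2 \<Rightarrow> 3 \<Rightarrow> (real^2) set" where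
  "region M j = {x \<in> T. \<forall>k. b M j * b x k \<le> b M k * b x j}"

text \<open>Along the line through \<open>y k\<close> and \<open>M\<close> the coordinates other
  than the k-th keep their proportions, so at the foot they are those of \<open>M\<close> rescaled
  to sum 1.\<close>

lemma barycentric_cevian_foot:
  assumes "\<And>j. 0 < b M j"
  shows "b (cevian_foot y M k) j = (if j = k then 0 else b M j / (1 - b M k))"
proof -
  obtain k' where k': "k' \<noteq> k" by (metis one_neq_zero)
  have "sum (b M) {k, k'} \<le> sum (b M) UNIV"
    by (rule sum_mono2) (auto simp: assms less_imp_le)
  then have lt: "b M k < 1" using assms[of k'] k' by (simp add: sum_barycentric)
  \<comment> \<open>The solution of \<open>t + (1 - t) * b M k = 0\<close>, which puts
    \<open>p\<close> on the edge opposite \<open>y k\<close>.\<close>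
  define t where "t = - b M k / (1 - b M k)"
  define p where "p = t *\<^sub>R y k + (1 - t) *\<^sub>R M"
  have t1: "1 - t = 1 / (1 - b M k)" using lt by (simp add: t_def field_simps)
  have bp: "b p j = (if j = k then 0 else b M j / (1 - b M k))" for j
  proof -
    have "b p j = t * b (y k) j + (1 - t) * b M j"
      unfolding p_def by (rule barycentric_affine_combination) simp
    then show ?thesis by (simp add: barycentric_vertex t1) (simp add: t_def)
  qed
  have "cevian_foot y M k = p" unfolding cevian_foot_def
  proof (rule the_equality)
    show "p \<in> affine hull {y k, M} \<and> p \<in> opposite_edge y k"
    proof
      show "p \<in> affine hull {y k, M}" unfolding affine_hull_2 p_def
        by simp (metis add.commute diff_add_cancel)
      show "p \<in> opposite_edge y k"
        using lt assms by (auto simp: in_opposite_edge_iff bp less_imp_le)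
    qed
  next
    fix q assume q: "q \<in> affine hull {y k, M} \<and> q \<in> opposite_edge y k"
    then obtain s s' where s: "q = s *\<^sub>R y k + s' *\<^sub>R M" "s + s' = 1" by (auto simp: affine_hull_2)
    have "b q k = 0" using q by (simp add: in_opposite_edge_iff)
    then have "s + s' * b M k = 0"
      unfolding s(1) by (subst (asm) barycentric_affine_combination[OF s(2)]) (simp add: barycentric_vertex)
    moreover have s': "s' = 1 - s" using s by simp
    ultimately have "s * (1 - b M k) = - b M k" by (simp add: algebra_simps)
    then have "s = t" using lt by (simp add: t_def field_simps)
    then show "q = p" using s s' by (simp add: p_def)
  qed
  then show ?thesis by (simp add: bp)
qed

text \<open>Since \<open>region M j\<close> is convex, it suffices to check the four corners of the
  quadrilateral.\<close>

lemma vertex_region_subset: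
  assumes "\<And>j. 0 < b M j"
  shows "vertex_region y M j \<subseteq> region M j"
  unfolding vertex_region_def
proof (rule hull_minimal)
  have "convex T" by (simp add: closed_triangle_def)
  then show "convex (region M j)"
    unfolding region_def
    by (auto intro!: convexI simp: barycentric_affine_combination distrib_left convexD
          mult.left_commute[of _ "_::real"] add_mono mult_left_mono)
  have le: "b M k \<le> 1" for k
    using member_le_sum[of k UNIV "b M"] assms by (simp add: sum_barycentric less_imp_le)
  show "{y j, M} \<union> cevian_foot y M ` (UNIV - {j}) \<subseteq> region M j"
    using assms le
    by (auto simp: region_def in_closed_triangle_iff barycentric_vertex barycentric_cevian_foot
        less_imp_le mult.commute)
qed

text \<open>In the region the j-th coordinate controls all others from above, so no coordinate of
  \<open>x\<close> exceeds that of \<open>M\<close> by more than \<open>c * d\<close>. Both families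
  sum to 1, which turns upper bounds into lower ones.\<close>

lemma norm_diff_le_in_region:
  assumes M: "\<And>j. 0 < b M j" and "\<And>j. c * b M j \<ge> 1"
    and x: "x \<in> region M j" "b x j \<le> b M j + d" "0 \<le> d"
  shows "norm (x - M) \<le> 2 * c * (\<Sum>j\<in>UNIV. norm (y j)) * d"
proof -
  have up: "b x k \<le> b M k + c * d" for k
  proof -
    have k1: "b M k \<le> 1"
      using member_le_sum[of k UNIV "b M"] M by (simp add: sum_barycentric less_imp_le)
    have "b M j * b x k \<le> b M k * b x j" using x by (simp add: region_def)
    also have "\<dots> \<le> b M k * (b M j + d)" using x M by (simp add: less_imp_le)
    also have "\<dots> \<le> b M k * b M j + 1 * d"
      using k1 x(3) by (simp add: distrib_left mult_left_le_one_le M less_imp_le)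
    also have "\<dots> \<le> b M k * b M j + (c * b M j) * d"
      using assms(2)[of j] x(3) by (intro add_left_mono mult_right_mono) auto
    finally have "b M j * b x k \<le> b M j * (b M k + c * d)" by (simp add: algebra_simps)
    then show ?thesis using M[of j] by simp
  qed
  have cd: "0 \<le> c * d"
  proof -
    have "0 < c * b M j" using assms(2)[of j] by linarith
    then have "0 < c" using M[of j] by (simp add: zero_less_mult_iff)
    then show ?thesis using x(3) by simp
  qed
  have ab: "\<bar>b x k - b M k\<bar> \<le> 2 * c * d" for k
  proof -
    have s: "sum (b x) UNIV = b x k + sum (b x) (UNIV - {k})"
      "sum (b M) UNIV = b M k + sum (b M) (UNIV - {k})" by (simp_all add: sum.remove)
    have "sum (b x) (UNIV - {k}) \<le> (\<Sum>i\<in>UNIV - {k}. b M i + c * d)" by (intro sum_mono up)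
    \<comment> \<open>The factor 2 counts the two indices other than \<open>k\<close>.\<close>
    also have "\<dots> = sum (b M) (UNIV - {k}) + 2 * (c * d)" by (simp add: sum.distrib)
    finally show ?thesis using s up[of k] cd by (simp add: sum_barycentric)
  qed
  have "x - M = (\<Sum>j\<in>UNIV. (b x j - b M j) *\<^sub>R y j)"
    by (simp add: scaleR_diff_left sum_subtractf barycentric_combination)
  also have "norm \<dots> \<le> (\<Sum>j\<in>UNIV. 2 * c * d * norm (y j))"
    by (rule order_trans[OF norm_sum sum_mono]) (simp add: ab mult_right_mono)
  finally show ?thesis by (simp add: sum_distrib_left algebra_simps)
qed

lemma closed_region: "closed (region M j)"
proof -
  have "region M j = T \<inter> (\<Inter>k. {x. b M j * b x k \<le> b M k * b x j})"
    by (auto simp: region_def)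
  also have "closed \<dots>"
    using compact_triangle
    by (intro closed_Int closed_INT ballI closed_Collect_le continuous_intros compact_imp_closed)
  finally show ?thesis .
qed

text \<open>Ensures that the inner triangle contains its frontier, hence \<open>M\<close>.\<close>

lemma closed_inner_triangle: "closed (inner_triangle y r)"
proof -
  have "inner_triangle y r = T \<inter> (\<Inter>k. {x. 1 - 1 / r \<le> b x k})"
    by (auto simp: inner_triangle_def)
  also have "closed \<dots>"
    using compact_triangle
    by (intro closed_Int closed_INT ballI closed_Collect_le continuous_intros compact_imp_closed)
  finally show ?thesis .
qed

section \<open>Areas and null sets\<close>

text \<open>The set is the image of \<open>T\<close> under the homothety with centre
  \<open>y j\<close> and ratio \<open>1 - d\<close>, which scales areas by the square of the
  ratio.\<close>

lemma measure_barycentric_ge: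
  assumes "0 \<le> d" "d < 1"
  shows "measure lborel {x \<in> T. d \<le> b x j} = (1 - d)\<^sup>2 * measure lborel T"
proof -
  have im: "{x \<in> T. d \<le> b x j} = (\<lambda>x. (1 - d) *\<^sub>R x + d *\<^sub>R y j) ` T"
  proof (intro set_eqI iffI)
    fix x assume x: "x \<in> {x \<in> T. d \<le> b x j}"
    \<comment> \<open>The preimage of \<open>x\<close> under the homothety.\<close>
    define z where "z = (1 / (1 - d)) *\<^sub>R x + (1 - 1 / (1 - d)) *\<^sub>R y j"
    have e: "1 - 1 / (1 - d) = - d / (1 - d)" using assms by (simp add: field_simps)
    have "b z k = (if k = j then (b x j - d) / (1 - d) else b x k / (1 - d))" for k
    proof -
      have "b z k = (1 / (1 - d)) * b x k + (1 - 1 / (1 - d)) * b (y j) k"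
        unfolding z_def by (rule barycentric_affine_combination) simp
      then show ?thesis unfolding e by (simp add: barycentric_vertex diff_divide_distrib)
    qed
    then have "z \<in> T" using x assms by (auto simp: in_closed_triangle_iff)
    moreover have "x = (1 - d) *\<^sub>R z + d *\<^sub>R y j"
      unfolding z_def e using assms by (simp add: scaleR_diff_right)
    ultimately show "x \<in> (\<lambda>x. (1 - d) *\<^sub>R x + d *\<^sub>R y j) ` T" by blast
  next
    fix x assume "x \<in> (\<lambda>x. (1 - d) *\<^sub>R x + d *\<^sub>R y j) ` T"
    then obtain z where z: "z \<in> T" "x = (1 - d) *\<^sub>R z + d *\<^sub>R y j" by blast
    have "b x k = (1 - d) * b z k + d * b (y j) k" for k
      unfolding z by (rule barycentric_affine_combination) simp
    then show "x \<in> {x \<in> T. d \<le> b x j}"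
      using z(1) assms by (auto simp: in_closed_triangle_iff barycentric_vertex)
  qed
  have "closed (T \<inter> {x. d \<le> b x j})"
    using compact_triangle
    by (intro closed_Int closed_Collect_le continuous_intros compact_imp_closed)
  then have "closed {x \<in> T. d \<le> b x j}" by (simp add: Collect_conj_eq)
  then have "measure lborel {x \<in> T. d \<le> b x j} = measure lebesgue {x \<in> T. d \<le> b x j}"
    by simp
  also have "\<dots> = (1 - d)\<^sup>2 * measure lebesgue T"
    unfolding im by (subst measure_lebesgue_affine) (use assms in simp)
  also have "measure lebesgue T = measure lborel T"
    using compact_triangle by (simp add: compact_imp_closed)
  finally show ?thesis .
qed

text \<open>The equation is affine in \<open>x\<close> and fails at \<open>y k\<close>, so its
  solutions form a line or the empty set. With the coordinates of \<open>M\<close> as factors these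
  are the cevians, on which \<open>v\<close> may be ambiguous.\<close>

lemma proportional_null:
  assumes "s \<noteq> 0" "j \<noteq> k"
  shows "{x. s * b x k = t * b x j} \<in> null_sets lborel"
proof -
  obtain P Q where a: "\<And>x j. b x j = P j \<bullet> x + Q j" using barycentric_affine by blast
  have eq: "{x. s * b x k = t * b x j} = {x. (s *\<^sub>R P k - t *\<^sub>R P j) \<bullet> x = t * Q j - s * Q k}"
    by (auto simp: a algebra_simps inner_diff_left)
  have "y k \<notin> {x. s * b x k = t * b x j}" using assms by (simp add: barycentric_vertex)
  then have "s *\<^sub>R P k - t *\<^sub>R P j \<noteq> 0 \<or> t * Q j - s * Q k \<noteq> 0" unfolding eq by auto
  then have "negligible {x. s * b x k = t * b x j}"
    unfolding eq by (rule negligible_hyperplane)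
  moreover have "{x. s * b x k = t * b x j} \<in> sets lborel" by measurable
  ultimately show ?thesis by (simp add: negligible_iff_null_sets null_sets_completion_iff)
qed

lemma measure_triangle_pos:
  assumes "M \<in> interior T"
  shows "0 < measure lborel T" "emeasure lborel T \<noteq> 0" "emeasure lborel T \<noteq> \<infinity>"
proof -
  have s: "T \<in> sets lborel" using compact_triangle by (simp add: compact_imp_closed)
  show fin: "emeasure lborel T \<noteq> \<infinity>"
    using emeasure_bounded_finite[OF compact_imp_bounded[OF compact_triangle]] by simp
  have "\<not> negligible (interior T)"
    using assms open_not_negligible[of "interior T"] by auto
  then have "\<not> negligible T" using interior_subset negligible_subset by blast
  then have "T \<notin> null_sets lborel"
    using s by (simp add: negligible_iff_null_sets null_sets_completion_iff)
  then show nz: "emeasure lborel T \<noteq> 0" using s by (auto simp: null_sets_def)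
  show "0 < measure lborel T"
    using nz fin by (simp add: measure_def enn2real_positive_iff less_top zero_less_iff_neq_zero)
qed

text \<open>Off the cevians through \<open>M\<close> the choice \<open>v\<close> is forced.\<close>
lemma domination_number_sample:
  assumes M: "\<And>j. 0 < b M j" and v: "vertex_choice y M v" and r: "1 \<le> r"
    and V: "finite V" "V \<noteq> {}" "V \<subseteq> T - range y"
    and off: "\<And>x j k. x \<in> V \<Longrightarrow> j \<noteq> k \<Longrightarrow> b M j * b x k \<noteq> b M k * b x j"
  shows "domination_number (proximity_digraph y r v V) > 1 \<longleftrightarrow>
    \<not> (\<exists>x\<in>V. \<exists>j. x \<in> region M j \<and> (\<forall>z\<in>V. 1 - b z j \<le> r * (1 - b x j)))"
proof -
  \<comment> \<open>A point in two regions satisfies two opposite inequalities, hence lies on a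
    cevian, which \<open>off\<close> forbids.\<close>
  have vx: "x \<in> region M j \<longleftrightarrow> j = v x" if "x \<in> V" for x j
  proof -
    have "x \<in> T - range y" using V(3) that by blast
    then have "x \<in> vertex_region y M (v x)" using v by (simp add: vertex_choice_def)
    then have R: "x \<in> region M (v x)" using vertex_region_subset[OF M] by blast
    have "j = v x" if "x \<in> region M j"
    proof (rule ccontr)
      assume "j \<noteq> v x"
      moreover have "b M j * b x (v x) = b M (v x) * b x j"
        using R that by (auto simp: region_def intro: antisym)
      ultimately show False using off \<open>x \<in> V\<close> by blast
    qed
    then show ?thesis using R by blast
  qed
  have "(w = s \<or> (s, w) \<in> parcs (proximity_digraph y r v V)) \<longleftrightarrow> 1 - b w (v s) \<le> r * (1 - b s (v s))"
    if s: "s \<in> V" "w \<in> V" for s w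
  proof -
    \<comment> \<open>As coordinates are at most 1 and \<open>r\<close> is at least 1,
      \<open>s\<close> satisfies its own proximity inequality. The alternative \<open>w = s\<close>
      is thereby absorbed.\<close>
    have "b s (v s) \<le> sum (b s) UNIV"
      using s V(3) by (intro member_le_sum) (auto simp: in_closed_triangle_iff)
    then have "1 * (1 - b s (v s)) \<le> r * (1 - b s (v s))"
      using r by (intro mult_right_mono) (auto simp: sum_barycentric)
    then show ?thesis
      using s V(3) by (auto simp: proximity_digraph_def proximity_region_def)
  qed
  moreover have "pverts (proximity_digraph y r v V) = V" by (simp add: proximity_digraph_def)
  ultimately show ?thesis
    using V by (subst domination_number_gt_1_iff) (auto simp: vx)
qed

end

section \<open>Uniform samples in the triangle\<close>

locale uniform_sample = triangle y + prob_space \<Omega> for y :: "3 \<Rightarrow> real^2" and \<Omega> :: "'w measure" +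
  fixes X :: "nat \<Rightarrow> 'w \<Rightarrow> real^2" and M :: "real^2"
  assumes indep: "indep_vars (\<lambda>_. borel) X UNIV"
    and distr_X: "\<And>i. distr \<Omega> borel (X i) = uniform_measure lborel (closed_triangle y)"
    and M_interior: "M \<in> interior (closed_triangle y)"
begin

lemma X_measurable [measurable]: "X i \<in> borel_measurable \<Omega>"
  using indep by (auto simp: indep_vars_def)

lemma T_sets [measurable]: "T \<in> sets borel"
  using compact_triangle by (simp add: compact_imp_closed)

lemma region_sets [measurable]: "region M j \<in> sets borel"
  using closed_region by (rule borel_closed)

lemma prob_X:
  assumes "A \<in> sets borel"
  shows "prob (X i -` A \<inter> space \<Omega>) = measure lborel (T \<inter> A) / measure lborel T"
proof -
  have "prob (X i -` A \<inter> space \<Omega>) = measure (distr \<Omega> borel (X i)) A"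
    using assms by (simp add: measure_distr)
  also have "\<dots> = measure lborel (T \<inter> A) / measure lborel T"
    unfolding distr_X using measure_triangle_pos[OF M_interior] assms
    by (intro measure_uniform_measure) auto
  finally show ?thesis .
qed

text \<open>Almost surely no sample point is a vertex or lies on a cevian through \<open>M\<close>;
  these are the conditions on \<open>V\<close> in \<open>domination_number_sample\<close>.\<close>

lemma AE_general_position:
  "AE \<omega> in \<Omega>. \<forall>i. X i \<omega> \<in> T - range y \<and> (\<forall>j k. j \<noteq> k \<longrightarrow> b M j * b (X i \<omega>) k \<noteq> b M k * b (X i \<omega>) j)"
proof -
  have M: "0 < b M j" for j using M_interior by (rule barycentric_pos_interior)
  have 1: "AE x in lborel. x \<notin> range y"
    by (rule AE_not_in) (simp add: finite_imp_null_set_lborel)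
  have 2: "AE x in lborel. j \<noteq> k \<longrightarrow> b M j * b x k \<noteq> b M k * b x j" for j k
  proof (cases "j = k")
    case False
    then have "{x. b M j * b x k = b M k * b x j} \<in> null_sets lborel"
      using M[of j] by (intro proportional_null) auto
    from AE_not_in[OF this] show ?thesis by simp
  qed simp
  have "AE x in lborel. x \<notin> range y \<and> (\<forall>j k. j \<noteq> k \<longrightarrow> b M j * b x k \<noteq> b M k * b x j)"
    using 1 2 by (simp add: AE_all_countable)
  then have *: "AE x in distr \<Omega> borel (X i). x \<in> T - range y \<and> (\<forall>j k. j \<noteq> k \<longrightarrow> b M j * b x k \<noteq> b M k * b x j)" for i
    unfolding distr_X by (intro AE_uniform_measureI) auto
  have "AE \<omega> in \<Omega>. X i \<omega> \<in> T - range y \<and> (\<forall>j k. j \<noteq> k \<longrightarrow> b M j * b (X i \<omega>) k \<noteq> b M k * b (X i \<omega>) j)" for i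
    by (rule AE_distrD[OF X_measurable *])
  then show ?thesis by (simp add: AE_all_countable)
qed

text \<open>The closed sets \<open>region M j\<close> replace the arbitrary choice \<open>v\<close>,
  which makes this event measurable.\<close>

definition single_dominator :: "real \<Rightarrow> nat \<Rightarrow> 'w set" where
  "single_dominator r n = {\<omega> \<in> space \<Omega>. \<exists>i<n. \<exists>j. X i \<omega> \<in> region M j \<and>
     (\<forall>k<n. 1 - b (X k \<omega>) j \<le> r * (1 - b (X i \<omega>) j))}"

lemma single_dominator_sets [measurable]: "single_dominator r n \<in> sets \<Omega>"
  unfolding single_dominator_def by measurable

text \<open>In general position the event is the complement of \<open>single_dominator r n\<close>.
  The two differ only within a null set, so the completion measures both and gives them the same
  value.\<close>

lemma measure_domination_number:
  assumes v: "vertex_choice y M v" and r: "1 \<le> r" and n: "0 < n"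
  shows "measure (completion \<Omega>)
      {\<omega> \<in> space \<Omega>. domination_number (proximity_digraph y r v ((\<lambda>i. X i \<omega>) ` {..<n})) > 1}
    = 1 - prob (single_dominator r n)" (is "measure _ ?A = _")
proof -
  have M: "0 < b M j" for j using M_interior by (rule barycentric_pos_interior)
  have "AE \<omega> in \<Omega>. \<omega> \<in> ?A \<longleftrightarrow> \<omega> \<in> space \<Omega> - single_dominator r n"
    using AE_general_position
  proof eventually_elim
    case (elim \<omega>)
    have "domination_number (proximity_digraph y r v ((\<lambda>i. X i \<omega>) ` {..<n})) > 1 \<longleftrightarrow>
      \<not> (\<exists>x\<in>(\<lambda>i. X i \<omega>) ` {..<n}. \<exists>j. x \<in> region M j \<and>
           (\<forall>z\<in>(\<lambda>i. X i \<omega>) ` {..<n}. 1 - b z j \<le> r * (1 - b x j)))"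
      using elim n by (intro domination_number_sample M v r) auto
    then show ?case by (simp add: single_dominator_def Bex_def Ball_def) blast
  qed
  then obtain N where N: "N \<in> null_sets \<Omega>"
      "{\<omega> \<in> space \<Omega>. \<not> (\<omega> \<in> ?A \<longleftrightarrow> \<omega> \<in> space \<Omega> - single_dominator r n)} \<subseteq> N"
    unfolding eventually_ae_filter by blast
  define B where "B = space \<Omega> - single_dominator r n"
  \<comment> \<open>A measurable set together with part of a null set, the form required for
    membership in the completion.\<close>
  have A: "?A = (B - N) \<union> (?A \<inter> N)" using N(2) by (auto simp: B_def)
  have Bs: "B - N \<in> sets \<Omega>" using N(1) by (auto simp: B_def)
  have "?A \<in> sets (completion \<Omega>)"
    by (rule sets_completionI[OF A _ N(1) Bs]) simp
  moreover have "AE \<omega> in completion \<Omega>. \<omega> \<in> ?A \<longleftrightarrow> \<omega> \<in> B"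
    using N by (intro AE_completion) (auto simp: B_def intro: AE_I'[of N])
  ultimately have "measure (completion \<Omega>) ?A = measure (completion \<Omega>) B"
    by (intro measure_eq_AE) (auto simp: B_def)
  also have "\<dots> = 1 - prob (single_dominator r n)"
    by (simp add: B_def prob_compl)
  finally show ?thesis .
qed

text \<open>One sample point satisfies the inequality with probability \<open>(1 - d)^2\<close>, at
  most \<open>exp (- d)\<close>; independence multiplies these bounds.\<close>

lemma prob_all_far:
  assumes d: "0 \<le> d" "d < 1" and n: "0 < n"
  shows "prob {\<omega> \<in> space \<Omega>. \<forall>i<n. d \<le> b (X i \<omega>) j} \<le> exp (- (real n * d))"
proof -
  have S: "{x. d \<le> b x j} \<in> sets borel" by measurable
  have p: "prob (X i -` {x. d \<le> b x j} \<inter> space \<Omega>) \<le> exp (- d)" for i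
  proof -
    have "prob (X i -` {x. d \<le> b x j} \<inter> space \<Omega>) = measure lborel {x \<in> T. d \<le> b x j} / measure lborel T"
      unfolding prob_X[OF S] by (simp add: Collect_conj_eq)
    also have "\<dots> = (1 - d)\<^sup>2"
      using measure_triangle_pos[OF M_interior] by (simp add: measure_barycentric_ge d)
    also have "\<dots> \<le> 1 - d" using d by (simp add: power2_eq_square mult_left_le)
    also have "\<dots> \<le> exp (- d)" using exp_ge_add_one_self[of "- d"] by simp
    finally show ?thesis .
  qed
  \<comment> \<open>For \<open>n = 0\<close> the intersection would be the universe instead of the
    sample space.\<close>
  have "{\<omega> \<in> space \<Omega>. \<forall>i<n. d \<le> b (X i \<omega>) j} = (\<Inter>i\<in>{..<n}. X i -` {x. d \<le> b x j} \<inter> space \<Omega>)"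
    using n by auto
  then have "prob {\<omega> \<in> space \<Omega>. \<forall>i<n. d \<le> b (X i \<omega>) j} = (\<Prod>i<n. prob (X i -` {x. d \<le> b x j} \<inter> space \<Omega>))"
    using n S by (simp only:, intro indep_varsD[OF indep]) auto
  also have "\<dots> \<le> (\<Prod>i<n. exp (- d))" by (intro prod_mono conjI measure_nonneg p)
  also have "\<dots> = exp (- (real n * d))" by (simp add: exp_of_nat_mult[symmetric])
  finally show ?thesis .
qed

text \<open>A union bound over the sample points, each weighted by the area of the disc relative to
  that of \<open>T\<close>.\<close>

lemma prob_some_near:
  assumes "0 \<le> \<rho>"
  shows "prob {\<omega> \<in> space \<Omega>. \<exists>i<n. X i \<omega> \<in> cball M \<rho>} \<le> real n * (unit_ball_vol 2 * \<rho>\<^sup>2 / measure lborel T)"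
proof -
  have p: "prob (X i -` cball M \<rho> \<inter> space \<Omega>) \<le> unit_ball_vol 2 * \<rho>\<^sup>2 / measure lborel T" for i
  proof -
    have "measure lborel (T \<inter> cball M \<rho>) \<le> measure lborel (cball M \<rho>)"
      using emeasure_lborel_cball_finite[of M \<rho>]
      by (intro measure_mono_fmeasurable) (auto simp: fmeasurable_def)
    also have "\<dots> = unit_ball_vol 2 * \<rho>\<^sup>2" using assms by (simp add: content_cball)
    finally show ?thesis by (simp add: prob_X divide_right_mono)
  qed
  have "{\<omega> \<in> space \<Omega>. \<exists>i<n. X i \<omega> \<in> cball M \<rho>} = (\<Union>i\<in>{..<n}. X i -` cball M \<rho> \<inter> space \<Omega>)"
    by auto
  also have "prob \<dots> \<le> (\<Sum>i<n. prob (X i -` cball M \<rho> \<inter> space \<Omega>))"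
    by (intro finite_measure_subadditive_finite) auto
  also have "\<dots> \<le> (\<Sum>i<n. unit_ball_vol 2 * \<rho>\<^sup>2 / measure lborel T)" by (intro sum_mono p)
  finally show ?thesis by simp
qed

text \<open>If one point dominates, then either all sample points have j-th coordinate at least
  \<open>d\<close> for some \<open>j\<close>, or some sample point is within \<open>K * d\<close> of
  \<open>M\<close>. The factor 3 counts the choices of \<open>j\<close>.\<close>

lemma prob_single_dominator_le:
  assumes c: "\<And>j. 1 \<le> c * b M j" "0 \<le> c" and r: "1 \<le> r" and Mr: "\<And>j. 1 - 1 / r \<le> b M j"
    and d: "0 \<le> d" "d < 1" and n: "0 < n"
    and K: "K = 2 * c * (\<Sum>j\<in>UNIV. norm (y j))"
  shows "prob (single_dominator r n) \<le>
    3 * exp (- (real n * d)) + real n * (unit_ball_vol 2 * (K * d)\<^sup>2 / measure lborel T)"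
proof -
  define F where "F j = {\<omega> \<in> space \<Omega>. \<forall>i<n. d \<le> b (X i \<omega>) j}" for j
  define N where "N = {\<omega> \<in> space \<Omega>. \<exists>i<n. X i \<omega> \<in> cball M (K * d)}"
  have [measurable]: "F j \<in> sets \<Omega>" for j
    unfolding F_def by measurable
  have "N = (\<Union>i\<in>{..<n}. X i -` cball M (K * d) \<inter> space \<Omega>)" by (auto simp: N_def)
  also have "\<dots> \<in> sets \<Omega>" by (intro sets.finite_UN measurable_sets[OF X_measurable]) auto
  finally have [measurable]: "N \<in> sets \<Omega>" .
  have M: "0 < b M j" for j using M_interior by (rule barycentric_pos_interior)
  have "single_dominator r n \<subseteq> (\<Union>j\<in>UNIV. F j) \<union> N"
  proof
    fix \<omega> assume "\<omega> \<in> single_dominator r n"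
    then obtain i j where w: "\<omega> \<in> space \<Omega>" "i < n" "X i \<omega> \<in> region M j"
      "\<And>k. k < n \<Longrightarrow> 1 - b (X k \<omega>) j \<le> r * (1 - b (X i \<omega>) j)"
      by (auto simp: single_dominator_def)
    show "\<omega> \<in> (\<Union>j\<in>UNIV. F j) \<union> N"
    proof (cases "\<omega> \<in> F j")
      case False
      then obtain k where k: "k < n" "b (X k \<omega>) j < d" using w(1) by (auto simp: F_def not_le)
      \<comment> \<open>The dominated point \<open>X k\<close>, whose j-th coordinate is below
        \<open>d\<close>, forces the dominator to have a small j-th coordinate.\<close>
      have "1 - d \<le> r * (1 - b (X i \<omega>) j)" using w(4)[OF k(1)] k(2) by simp
      then have "(1 - d) / r \<le> 1 - b (X i \<omega>) j" using r by (simp add: field_simps)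
      then have "b (X i \<omega>) j \<le> 1 - 1 / r + d / r" by (simp add: diff_divide_distrib)
      \<comment> \<open>Here the position of \<open>M\<close> enters through \<open>Mr\<close>, and
        \<open>d / r\<close> is at most \<open>d\<close> because \<open>r\<close> is at least
        1.\<close>
      also have "\<dots> \<le> b M j + d"
        using r Mr[of j] mult_left_mono[OF r d(1)] by (intro add_mono) (simp_all add: divide_le_eq)
      finally have "norm (X i \<omega> - M) \<le> K * d"
        unfolding K using norm_diff_le_in_region[of M c, OF M c(1) w(3)] d by blast
      then show ?thesis using w by (auto simp: N_def dist_norm norm_minus_commute)
    qed auto
  qed
  then have "prob (single_dominator r n) \<le> prob ((\<Union>j\<in>UNIV. F j) \<union> N)"
    by (intro finite_measure_mono) auto
  also have "\<dots> \<le> prob (\<Union>j\<in>UNIV. F j) + prob N"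
    by (rule measure_Un_le) auto
  also have "\<dots> \<le> 3 * exp (- (real n * d)) +
      real n * (unit_ball_vol 2 * (K * d)\<^sup>2 / measure lborel T)"
  proof (rule add_mono)
    have "prob (\<Union>j\<in>UNIV. F j) \<le> (\<Sum>j\<in>UNIV. prob (F j))"
      by (intro finite_measure_subadditive_finite) auto
    also have "\<dots> \<le> (\<Sum>j\<in>(UNIV::3 set). exp (- (real n * d)))"
      unfolding F_def by (intro sum_mono prob_all_far d n)
    finally show "prob (\<Union>j\<in>UNIV. F j) \<le> 3 * exp (- (real n * d))" by simp
    show "prob N \<le> real n * (unit_ball_vol 2 * (K * d)\<^sup>2 / measure lborel T)"
      unfolding N_def using c(2) d by (intro prob_some_near) (simp add: K sum_nonneg)
  qed
  finally show ?thesis .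
qed

text \<open>With \<open>d = n powr (-3/4)\<close> the two error terms are of order
  \<open>exp (- (n powr (1/4)))\<close> and \<open>n powr (-1/2)\<close>.\<close>

lemma single_dominator_tendsto_0:
  assumes r: "1 \<le> r" and Mr: "\<And>j. 1 - 1 / r \<le> b M j"
  shows "(\<lambda>n. prob (single_dominator r n)) \<longlonglongrightarrow> 0"
proof -
  have M: "0 < b M j" for j using M_interior by (rule barycentric_pos_interior)
  \<comment> \<open>A sum of positive reciprocals dominates each of them, giving one constant valid
    for all \<open>j\<close>.\<close>
  define c where "c = (\<Sum>j\<in>UNIV. 1 / b M j)"
  have c0: "0 \<le> c" unfolding c_def using M by (intro sum_nonneg) (simp add: less_imp_le)
  have c: "1 \<le> c * b M j" for j
  proof -
    have "1 / b M j \<le> c"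
      unfolding c_def using M by (intro member_le_sum) (auto simp: less_imp_le)
    then show ?thesis using M[of j] by (simp add: field_simps)
  qed
  define K where "K = 2 * c * (\<Sum>j\<in>UNIV. norm (y j))"
  define A where "A = unit_ball_vol 2 * K\<^sup>2 / measure lborel T"
  have b: "prob (single_dominator r n) \<le>
      3 * exp (- (real n * real n powr (-3/4))) + real n * (A * (real n powr (-3/4))\<^sup>2)"
    if "n > 1" for n
  proof -
    have "real n powr (-3/4) < 1" using that by (intro powr_less_one) auto
    then show ?thesis
      using prob_single_dominator_le[OF c c0 r Mr _ _ _ K_def, of "real n powr (-3/4)" n] that
      by (simp add: A_def power_mult_distrib)
  qed
  have "(\<lambda>n. 3 * exp (- (real n * real n powr (-3/4)))) \<longlonglongrightarrow> 0" by real_asymp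
  moreover have "(\<lambda>n. real n * (real n powr (-3/4))\<^sup>2) \<longlonglongrightarrow> 0" by real_asymp
  then have "(\<lambda>n. A * (real n * (real n powr (-3/4))\<^sup>2)) \<longlonglongrightarrow> A * 0"
    by (rule tendsto_mult_left)
  ultimately have "(\<lambda>n. 3 * exp (- (real n * real n powr (-3/4))) + A * (real n * (real n powr (-3/4))\<^sup>2))
      \<longlonglongrightarrow> 0 + A * 0"
    by (rule tendsto_add)
  then have lim: "(\<lambda>n. 3 * exp (- (real n * real n powr (-3/4))) + real n * (A * (real n powr (-3/4))\<^sup>2))
      \<longlonglongrightarrow> 0"
    by (simp add: mult.left_commute)
  show ?thesis
  proof (rule real_tendsto_sandwich[OF _ _ tendsto_const lim])
    show "\<forall>\<^sub>F n in sequentially. prob (single_dominator r n) \<le>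
      3 * exp (- (real n * real n powr (-3/4))) + real n * (A * (real n powr (-3/4))\<^sup>2)"
      using eventually_gt_at_top[of 1] by eventually_elim (rule b)
  qed simp
qed

end

theorem theorem7:
  fixes y :: "3 \<Rightarrow> real^2" and r :: real and M :: "real^2" and v :: "real^2 \<Rightarrow> 3"
    and \<Omega> :: "'w measure" and X :: "nat \<Rightarrow> 'w \<Rightarrow> real^2"
  assumes "\<not> collinear {y 1, y 2, y 3}"
    and "1 \<le> r" and "r \<le> 3 / 2"
    and "M \<in> frontier (inner_triangle y r)"
    and "M \<in> interior (closed_triangle y)"
    and "vertex_choice y M v"
    and "prob_space \<Omega>"
    and "prob_space.indep_vars \<Omega> (\<lambda>_. borel) X UNIV"
    and "\<And>i. distr \<Omega> borel (X i) = uniform_measure lborel (closed_triangle y)"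
  shows "(\<lambda>n. measure (completion \<Omega>)
            {\<omega> \<in> space \<Omega>.
               domination_number (proximity_digraph y r v ((\<lambda>i. X i \<omega>) ` {..<n})) > 1})
         \<longlonglongrightarrow> 1"
proof -
  interpret triangle y by unfold_locales fact
  interpret uniform_sample y \<Omega> X M
    using assms by (auto simp: uniform_sample_def uniform_sample_axioms_def triangle_def)
  have "M \<in> inner_triangle y r"
    using assms(4) closed_inner_triangle by (simp add: frontier_def)
  then have Mr: "1 - 1 / r \<le> barycentric y M j" for j by (simp add: inner_triangle_def)
  have "(\<lambda>n. 1 - prob (single_dominator r n)) \<longlonglongrightarrow> 1"
    using tendsto_diff[OF tendsto_const single_dominator_tendsto_0[OF assms(2) Mr], of 1] by simp
  then show ?thesis
  proof (rule Lim_transform_eventually)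
    show "\<forall>\<^sub>F n in sequentially. 1 - prob (single_dominator r n) =
        measure (completion \<Omega>) {\<omega> \<in> space \<Omega>.
          domination_number (proximity_digraph y r v ((\<lambda>i. X i \<omega>) ` {..<n})) > 1}"
      \<comment> \<open>An empty sample has domination number 0, so the identity of probabilities
        starts at \<open>n = 1\<close>.\<close>
      using eventually_gt_at_top[of 0]
      by eventually_elim (rule measure_domination_number[OF assms(6,2), symmetric])
  qed
qed

end
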